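(* Let $f$ be an analytic function in $\mathbb{D}$. Then for every integer $n\geq 1$ and every $z\in\mathbb{D}$, $$|f^{(n)}(z)|\leq\frac{n!\,4\,\sup_{\zeta\in\mathbb{D}}|\operatorname{Re} f(\zeta)|}{\pi}\,\frac{1}{(1-|z|)^{n}(1+|z|)}.$$
   Context: $\mathbb{D}=\{z\in\mathbb{C}:|z|<1\}$ is the open unit disk. If the supremum is $+\infty$ the right-hand side is understood to be $+\infty$. *)

theory Defs
  imports "HOL-Complex_Analysis.Complex_Analysis"
begin

end

theory Submission imports Defs begin

text \<open>
  Let \<open>M\<close> be the supremum of \<open>\<bar>Re f\<bar>\<close> over the disc. If \<open>M\<close> is infinite, so is the right-hand side;
  let \<open>M\<close> be finite.

  At the origin the estimate says that every Taylor coefficient \<open>c\<^sub>k\<close> with \<open>k > 0\<close> has modulus at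
  most \<open>4 M / \<pi>\<close> (\<open>taylor_coefficient_bound\<close>). On a circle of radius \<open>r < 1\<close> about the origin,
  \<open>cnj f\<close> has only non-positive frequencies and \<open>f\<close> only non-negative ones, so \<open>c\<^sub>k r\<^sup>k\<close> is the
  \<open>k\<close>-th Fourier coefficient of \<open>2 Re f\<close>. After a rotation, \<open>2 \<pi> \<bar>c\<^sub>k\<bar> r\<^sup>k\<close> is the integral of
  \<open>2 Re f\<close> against \<open>cos (k t + \<theta>)\<close>, whose absolute value has integral 4 over a period
  (\<open>has_integral_abs_cos\<close>). Bounding the cosine in this way, and not by 1, gives the constant
  \<open>4 / \<pi>\<close>.

  For an arbitrary \<open>z\<close>, let \<open>F\<close> be \<open>f\<close> composed with the disc automorphism that takes 0 to \<open>z\<close>.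
  It has the same bound on the real part, so its coefficients are at most \<open>4 M / \<pi>\<close>. With
  \<open>s = 1 - \<bar>z\<bar>\<^sup>2\<close>, the inverse automorphism is \<open>z + u \<mapsto> u / (s - cnj z u)\<close>. Calling its power
  series \<open>b\<close>, composition of power series gives
  \<open>f\<^sup>(\<^sup>n\<^sup>) (z) / n! = \<Sum>i=1..n. F\<^sub>i \<cdot> [u\<^sup>n] b\<^sup>i\<close>.
  The absolute values of the numbers \<open>[u\<^sup>n] b\<^sup>i\<close> add up to at most \<open>(1 + \<bar>z\<bar>)\<^sup>n\<^sup>-\<^sup>1 / s\<^sup>n\<close>
  (\<open>sum_norm_power_coeffs\<close>), which is \<open>1 / ((1 - \<bar>z\<bar>)\<^sup>n (1 + \<bar>z\<bar>))\<close> because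
  \<open>s = (1 - \<bar>z\<bar>) (1 + \<bar>z\<bar>)\<close>.
\<close>

section \<open>Taylor coefficients at the origin\<close>

text \<open>
  An antiderivative \<open>Q\<close> of \<open>\<bar>cos\<bar>\<close> on the whole line grows by 2 over every interval of length
  \<open>\<pi>\<close>, and the interval swept by \<open>k t + \<theta>\<close> consists of \<open>2 k\<close> of them.
\<close>
lemma has_integral_abs_cos:
  fixes k :: nat and \<theta> :: real
  assumes "k > 0"
  shows "((\<lambda>t. \<bar>cos (real k * t + \<theta>)\<bar>) has_integral 4) {0..2*pi}"
proof -
  have "\<exists>Q. \<forall>x::real. (Q has_vector_derivative \<bar>cos x\<bar>) (at x)"
    using einterval_antiderivative[of "-\<infinity>" "\<infinity>" "\<lambda>x. \<bar>cos x\<bar>"] by auto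
  then obtain Q where Q: "\<And>x::real. (Q has_real_derivative \<bar>cos x\<bar>) (at x)"
    by (auto simp: has_real_derivative_iff_has_vector_derivative)
  \<comment> \<open>Since \<open>\<bar>cos\<bar>\<close> has period \<open>\<pi>\<close>, the growth does not depend on where the interval starts, and
    it can be computed where the cosine is non-negative.\<close>
  have const: "Q (x + pi) - Q x = Q (y + pi) - Q y" for x y
  proof -
    have "((\<lambda>x. Q (x + pi) - Q x) has_real_derivative \<bar>cos (x+pi)\<bar> * 1 - \<bar>cos x\<bar>) (at x)" for x
      by (intro derivative_intros DERIV_chain2[OF Q] Q) (auto intro!: derivative_eq_intros)
    then have "((\<lambda>x. Q (x + pi) - Q x) has_real_derivative 0) (at x)" for x
      by simp
    then show ?thesis
      by (intro DERIV_isconst_all) auto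
  qed
  have "Q (-(pi/2) + pi) - Q (-(pi/2)) = 2"
  proof -
    have "(cos has_integral (sin (pi/2) - sin (-(pi/2)))) {-(pi/2)..pi/2}"
      by (intro fundamental_theorem_of_calculus)
         (auto simp flip: has_real_derivative_iff_has_vector_derivative intro!: derivative_eq_intros)
    moreover have "((\<lambda>x. \<bar>cos x\<bar>) has_integral (Q (pi/2) - Q (-(pi/2)))) {-(pi/2)..pi/2}"
      by (intro fundamental_theorem_of_calculus)
         (auto simp flip: has_real_derivative_iff_has_vector_derivative
               intro: has_field_derivative_at_within Q)
    then have "(cos has_integral (Q (pi/2) - Q (-(pi/2)))) {-(pi/2)..pi/2}"
      by (rule has_integral_eq[rotated]) (auto intro!: abs_of_nonneg cos_ge_zero)
    ultimately have "Q (pi/2) - Q (-(pi/2)) = sin (pi/2) - sin (-(pi/2))"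
      by (rule has_integral_unique[rotated])
    then show ?thesis by simp
  qed
  then have step: "Q (x + pi) = Q x + 2" for x
    using const[of x "-(pi/2)"] by simp
  have shift: "Q (x + real m * pi) = Q x + 2 * real m" for x m
  proof (induction m)
    case (Suc m)
    then show ?case using step[of "x + real m * pi"] by (simp add: algebra_simps)
  qed simp
  have "((\<lambda>t. Q (real k * t + \<theta>) / real k) has_real_derivative \<bar>cos (real k * t + \<theta>)\<bar>) (at t within A)"
    for t A
  proof -
    have "((\<lambda>t. real k * t + \<theta>) has_real_derivative real k) (at t)"
      by (auto intro!: derivative_eq_intros)
    then have "((\<lambda>t. Q (real k * t + \<theta>)) has_real_derivative \<bar>cos (real k * t + \<theta>)\<bar> * real k) (at t)"
      by (rule DERIV_chain2[OF Q])
    then have "((\<lambda>t. Q (real k * t + \<theta>) / real k) has_real_derivative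
        \<bar>cos (real k * t + \<theta>)\<bar> * real k / real k) (at t)"
      by (rule DERIV_cdivide)
    then show ?thesis
      using assms by (simp add: has_field_derivative_at_within)
  qed
  then have "((\<lambda>t. \<bar>cos (real k * t + \<theta>)\<bar>) has_integral
      (Q (real k * (2*pi) + \<theta>) / real k - Q (real k * 0 + \<theta>) / real k)) {0..2*pi}"
    by (intro fundamental_theorem_of_calculus)
       (auto simp flip: has_real_derivative_iff_has_vector_derivative)
  moreover have "Q (real k * (2*pi) + \<theta>) = Q \<theta> + 4 * real k"
    using shift[of \<theta> "2*k"] by (simp add: algebra_simps)
  ultimately show ?thesis using assms by (simp add: field_simps)
qed

text \<open>
  The classical estimate for functions that map the disc into the strip \<open>\<bar>Re w\<bar> \<le> M\<close>. It fails
  for \<open>k = 0\<close>, since the imaginary part of \<open>f 0\<close> is not controlled.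
\<close>
lemma taylor_coefficient_bound:
  fixes f :: "complex \<Rightarrow> complex"
  assumes holf: "f holomorphic_on ball 0 1"
    and bound: "\<And>w. w \<in> ball 0 1 \<Longrightarrow> \<bar>Re (f w)\<bar> \<le> M"
    and "k > 0"
  shows "cmod (fps_nth (fps_expansion f 0) k) \<le> 4 * M / pi"
proof -
  define c where "c = (deriv ^^ k) f 0 / fact k"
  have cancel_div: "R ^ k / \<i> * (F / (R * w) ^ Suc k * R * \<i> * w) = F * inverse (w ^ k)"
    and cancel_mult: "1 / (\<i> * R ^ k) * (F * (R * w) ^ (k - 1) * R * \<i> * w) = F * w ^ k"
    if "R \<noteq> 0" "w \<noteq> 0" for R F w :: complex
    using that \<open>k > 0\<close> by (cases k; simp add: power_mult_distrib field_simps)+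
  have radius_r: "cmod c * r ^ k \<le> 4 * M / pi" if r: "0 < r" "r < 1" for r :: real
  proof -
    have in_ball: "complex_of_real r * cis t \<in> ball 0 1" for t
      using r by (simp add: norm_mult)
    \<comment> \<open>Frequency \<open>k\<close>: Cauchy's formula for the \<open>k\<close>-th derivative.\<close>
    have "((\<lambda>u. f u / (u - 0) ^ Suc k) has_contour_integral (2 * pi * \<i>) / fact k * (deriv ^^ k) f 0)
            (circlepath 0 r)"
      by (rule Cauchy_has_contour_integral_higher_derivative_circlepath)
         (use r in \<open>auto intro!: holomorphic_on_imp_continuous_on intro: holomorphic_on_subset[OF holf]\<close>)
    then have "((\<lambda>t. f (r * cis t) / (r * cis t) ^ Suc k * r * \<i> * cis t) has_integral
        2 * pi * \<i> * c) {0..2*pi}"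
      unfolding circlepath_def
      by (subst (asm) has_contour_integral_part_circlepath_iff) (auto simp: c_def mult_ac)
    note scaled = has_integral_mult_right[OF this, of "of_real r ^ k / \<i>"]
    have integrand: "complex_of_real r ^ k / \<i> * (f (r * cis t) / (r * cis t) ^ Suc k * r * \<i> * cis t)
        = f (r * cis t) * cis (-(k * t))" for t :: real
    proof -
      have inv: "cis (-(k * t)) = inverse (cis t ^ k)"
        by (simp only: Complex.DeMoivre cis_inverse)
      show ?thesis unfolding inv by (rule cancel_div) (use r in auto)
    qed
    have "complex_of_real r ^ k / \<i> * (of_real (2 * pi) * \<i> * c) = of_real (2 * pi * r ^ k) * c"
    proof -
      have "R / \<i> * (p * \<i> * c) = p * R * c" for R p by (simp add: field_simps)
      then show ?thesis by (simp only: of_real_mult of_real_power)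
    qed
    with scaled have coeff:
      "((\<lambda>t. f (r * cis t) * cis (-(k * t))) has_integral of_real (2 * pi * r ^ k) * c) {0..2*pi}"
      by (simp only: integrand)
    \<comment> \<open>Frequency \<open>-k\<close>: Cauchy's theorem gives 0. Conjugated, this adds \<open>cnj f\<close> to the formula for
      frequency \<open>k\<close> without changing its value, which turns \<open>f\<close> into \<open>2 Re f\<close>.\<close>
    have "(\<lambda>u. f u * u ^ (k - 1)) holomorphic_on ball 0 1"
      by (intro holomorphic_intros holf)
    then have "((\<lambda>u. f u * u ^ (k - 1)) has_contour_integral 0) (circlepath 0 r)"
      by (rule Cauchy_theorem_convex_simple) (use r in \<open>auto simp: path_image_circlepath_nonneg\<close>)
    then have "((\<lambda>t. f (r * cis t) * (r * cis t) ^ (k - 1) * r * \<i> * cis t) has_integral 0) {0..2*pi}"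
      unfolding circlepath_def
      by (subst (asm) has_contour_integral_part_circlepath_iff) auto
    note scaled = has_integral_mult_right[OF this, of "1 / (\<i> * of_real r ^ k)"]
    have "1 / (\<i> * complex_of_real r ^ k) * (f (r * cis t) * (r * cis t) ^ (k - 1) * r * \<i> * cis t)
        = f (r * cis t) * cis (k * t)" for t :: real
    proof -
      have pow: "cis (k * t) = cis t ^ k"
        by (simp only: Complex.DeMoivre)
      show ?thesis unfolding pow by (rule cancel_mult) (use r in auto)
    qed
    with scaled have "((\<lambda>t. f (r * cis t) * cis (k * t)) has_integral 0) {0..2*pi}"
      by (simp only: mult_zero_right)
    then have "((cnj \<circ> (\<lambda>t. f (r * cis t) * cis (k * t))) has_integral cnj 0) {0..2*pi}"
      by (simp only: has_integral_cnj)
    note added = has_integral_add[OF coeff this]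
    have "f (r * cis t) * cis (-(k * t)) + (cnj \<circ> (\<lambda>t. f (r * cis t) * cis (k * t))) t
        = complex_of_real (2 * Re (f (r * cis t))) * cis (-(k * t))" for t :: real
      by (simp add: complex_eq_iff)
    with added have "((\<lambda>t. complex_of_real (2 * Re (f (r * cis t))) * cis (-(k * t))) has_integral
        of_real (2 * pi * r ^ k) * c) {0..2*pi}"
      by (simp only: complex_cnj_zero add_0_right)
    \<comment> \<open>The factor \<open>cis (- Arg c)\<close> rotates the value to the positive real axis, so that taking real
      parts loses nothing.\<close>
    from has_integral_mult_right[OF this, of "cis (- Arg c)"]
    have "((\<lambda>t. Re (cis (- Arg c) * (complex_of_real (2 * Re (f (r * cis t))) * cis (-(k * t))))) has_integral
        Re (cis (- Arg c) * (of_real (2 * pi * r ^ k) * c))) {0..2*pi}"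
      by (rule has_integral_Re)
    moreover have "Re (cis (- Arg c) * (of_real (2 * pi * r ^ k) * c)) = 2 * pi * r ^ k * cmod c"
    proof -
      have "cis (- Arg c) * c = cis (- Arg c) * rcis (cmod c) (Arg c)"
        by (simp only: rcis_cmod_Arg)
      also have "\<dots> = of_real (cmod c) * (cis (- Arg c) * cis (Arg c))"
        by (simp only: rcis_def mult.left_commute)
      finally have "cis (- Arg c) * c = of_real (cmod c)"
        by (simp only: cis_mult add.left_inverse cis_zero mult_1_right)
      then have "cis (- Arg c) * (of_real (2 * pi * r ^ k) * c) = of_real (2 * pi * r ^ k) * of_real (cmod c)"
        by (simp only: mult.left_commute[of "cis (- Arg c)" "of_real (2 * pi * r ^ k)"])
      then show ?thesis by (simp only: Re_complex_of_real flip: of_real_mult)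
    qed
    moreover have "Re (cis (- Arg c) * (complex_of_real (2 * Re (f (r * cis t))) * cis (-(k * t))))
        = 2 * Re (f (r * cis t)) * cos (real k * t + Arg c)" for t :: real
      by (simp add: cos_add algebra_simps)
    ultimately have left: "((\<lambda>t. 2 * Re (f (r * cis t)) * cos (real k * t + Arg c)) has_integral
        2 * pi * r ^ k * cmod c) {0..2*pi}"
      by (simp only:)
    have right: "((\<lambda>t. 2 * M * \<bar>cos (real k * t + Arg c)\<bar>) has_integral 2 * M * 4) {0..2*pi}"
      by (intro has_integral_mult_right has_integral_abs_cos \<open>k > 0\<close>)
    have "2 * pi * r ^ k * cmod c \<le> 2 * M * 4"
    proof (rule has_integral_le[OF left right])
      fix t
      have "2 * Re (f (r * cis t)) * cos (real k * t + Arg c)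
          \<le> \<bar>2 * Re (f (r * cis t)) * cos (real k * t + Arg c)\<bar>" by (rule abs_ge_self)
      also have "\<dots> = 2 * \<bar>Re (f (r * cis t))\<bar> * \<bar>cos (real k * t + Arg c)\<bar>"
        by (simp add: abs_mult)
      also have "\<dots> \<le> 2 * M * \<bar>cos (real k * t + Arg c)\<bar>"
        using bound[OF in_ball[of t]] by (intro mult_right_mono) auto
      finally show "2 * Re (f (r * cis t)) * cos (real k * t + Arg c)
          \<le> 2 * M * \<bar>cos (real k * t + Arg c)\<bar>" .
    qed
    moreover have "d * R \<le> 4 * M / pi" if "2 * pi * R * d \<le> 2 * M * 4" for d R :: real
      using that by (simp add: field_simps)
    ultimately show ?thesis by blast
  qed
  have "((\<lambda>r. cmod c * r ^ k) \<longlongrightarrow> cmod c * 1 ^ k) (at_left (1::real))"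
    by (intro tendsto_intros)
  moreover have "\<forall>\<^sub>F r in at_left (1::real). cmod c * r ^ k \<le> 4 * M / pi"
  proof -
    have "\<forall>\<^sub>F r in at_left (1::real). r \<in> {0<..<1}"
      by (rule eventually_at_left_real) simp
    then show ?thesis by eventually_elim (auto intro!: radius_r)
  qed
  ultimately have "cmod c * 1 ^ k \<le> 4 * M / pi"
    by (intro tendsto_upperbound) auto
  then show ?thesis by (simp add: c_def fps_expansion_def)
qed

section \<open>Transfer to an arbitrary point of the disc\<close>

text \<open>
  The hypothesis says \<open>b = X / (s - a X)\<close>. Comparing coefficients in \<open>b\<^sup>i\<^sup>+\<^sup>1 (s - a X) = X b\<^sup>i\<close>
  gives a recursion of Pascal type, \<open>s [X\<^sup>n\<^sup>+\<^sup>1] b\<^sup>i\<^sup>+\<^sup>1 = [X\<^sup>n] b\<^sup>i + a [X\<^sup>n] b\<^sup>i\<^sup>+\<^sup>1\<close>. Summed over \<open>i\<close>,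
  it shows that the row sum of absolute values grows at most by the factor \<open>(1 + \<bar>a\<bar>) / s\<close> from one
  \<open>n\<close> to the next.
\<close>
lemma sum_norm_power_coeffs:
  fixes a :: complex and s :: real and b :: "complex fps"
  assumes b: "b * (fps_const (of_real s) - fps_const a * fps_X) = fps_X"
    and "s > 0"
  shows "(\<Sum>i=1..Suc m. cmod (fps_nth (b ^ i) (Suc m))) \<le> (1 + cmod a) ^ m / s ^ Suc m"
proof -
  have rec: "cmod (fps_nth (b ^ Suc i) (Suc n))
      \<le> (cmod (fps_nth (b ^ i) n) + cmod a * cmod (fps_nth (b ^ Suc i) n)) / s" for i n
  proof -
    have "b ^ Suc i * (fps_const (of_real s) - fps_const a * fps_X) = fps_X * b ^ i"
      using b by (simp add: mult_ac)
    then have "fps_nth (b ^ Suc i * (fps_const (of_real s) - fps_const a * fps_X)) (Suc n)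
        = fps_nth (fps_X * b ^ i) (Suc n)"
      by (rule arg_cong)
    moreover have "b ^ Suc i * (fps_const (of_real s) - fps_const a * fps_X)
        = fps_const (of_real s) * b ^ Suc i - fps_const a * (fps_X * b ^ Suc i)"
      by (simp only: algebra_simps)
    ultimately have "of_real s * fps_nth (b ^ Suc i) (Suc n)
        = fps_nth (b ^ i) n + a * fps_nth (b ^ Suc i) n"
      by (simp del: power_Suc add: algebra_simps)
    then have "cmod (of_real s * fps_nth (b ^ Suc i) (Suc n))
        \<le> cmod (fps_nth (b ^ i) n) + cmod (a * fps_nth (b ^ Suc i) n)"
      by (simp del: power_Suc only: norm_triangle_ineq)
    then show ?thesis
      using \<open>s > 0\<close> by (simp del: power_Suc add: norm_mult field_simps)
  qed
  have b0: "fps_nth b 0 = 0"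
    using arg_cong[OF b, of "\<lambda>x. fps_nth x 0"] \<open>s > 0\<close> by simp
  have above: "fps_nth (b ^ i) n = 0" if "n < i" for i n
    using startsby_zero_power_prefix[OF b0] that by blast
  show ?thesis
  proof (induction m)
    case 0
    show ?case using rec[of 0 0] b0 by simp
  next
    case (Suc m)
    let ?T = "\<Sum>i=1..Suc m. cmod (fps_nth (b ^ i) (Suc m))"
    have "(\<Sum>i=1..Suc (Suc m). cmod (fps_nth (b ^ i) (Suc (Suc m))))
        = (\<Sum>i=0..Suc m. cmod (fps_nth (b ^ Suc i) (Suc (Suc m))))"
      by (simp only: sum.shift_bounds_cl_Suc_ivl One_nat_def)
    also have "\<dots> \<le> (\<Sum>i=0..Suc m. (cmod (fps_nth (b ^ i) (Suc m))
        + cmod a * cmod (fps_nth (b ^ Suc i) (Suc m))) / s)"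
      by (intro sum_mono rec)
    also have "\<dots> = ((\<Sum>i=0..Suc m. cmod (fps_nth (b ^ i) (Suc m)))
        + cmod a * (\<Sum>i=0..Suc m. cmod (fps_nth (b ^ Suc i) (Suc m)))) / s"
      by (simp only: sum.distrib sum_distrib_left flip: sum_divide_distrib)
    also have "(\<Sum>i=0..Suc m. cmod (fps_nth (b ^ i) (Suc m))) = ?T"
      by (subst sum.atLeast_Suc_atMost) auto
    also have "(\<Sum>i=0..Suc m. cmod (fps_nth (b ^ Suc i) (Suc m)))
        = (\<Sum>i=1..Suc (Suc m). cmod (fps_nth (b ^ i) (Suc m)))"
      by (simp only: sum.shift_bounds_cl_Suc_ivl One_nat_def)
    \<comment> \<open>\<open>b\<close> has no constant term, so the additional power \<open>b\<^sup>m\<^sup>+\<^sup>2\<close> starts beyond degree \<open>m + 1\<close>.\<close>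
    also have "\<dots> = ?T"
      using above[of "Suc m" "Suc (Suc m)"] by (simp del: power_Suc)
    also have "(?T + cmod a * ?T) / s = (1 + cmod a) / s * ?T"
      using \<open>s > 0\<close> by (simp only: distrib_right times_divide_eq_left mult_1_left)
    also have "\<dots> \<le> (1 + cmod a) / s * ((1 + cmod a) ^ m / s ^ Suc m)"
      using \<open>s > 0\<close> by (intro mult_left_mono Suc.IH) auto
    finally show ?case by simp
  qed
qed

text \<open>
  The theorem for a finite bound \<open>M\<close> on \<open>\<bar>Re f\<bar>\<close>, by transport of the coefficient bound along the
  automorphism \<open>Moebius_function 0 (-z)\<close>, which takes 0 to \<open>z\<close>.
\<close>
lemma higher_deriv_bound_bounded_Re:
  fixes f :: "complex \<Rightarrow> complex"
  assumes holf: "f holomorphic_on ball 0 1"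
    and bound: "\<And>w. w \<in> ball 0 1 \<Longrightarrow> \<bar>Re (f w)\<bar> \<le> M"
    and "n > 0" and z: "z \<in> ball 0 1"
  shows "cmod ((deriv ^^ n) f z) \<le> fact n * 4 * M / pi * (1 / ((1 - cmod z) ^ n * (1 + cmod z)))"
proof -
  define s where "s = 1 - (cmod z)\<^sup>2"
  define F where "F = f \<circ> Moebius_function 0 (-z)"
  define G where "G = fps_expansion F 0"
  define b where "b = fps_X / (fps_const (complex_of_real s) - fps_const (cnj z) * fps_X)"
  have z1: "cmod z < 1" using z by simp
  have s_factor: "s = (1 - cmod z) * (1 + cmod z)"
    by (simp add: s_def power2_eq_square algebra_simps)
  then have s: "s > 0" using z1 by (simp add: mult_pos_pos add_pos_nonneg)
  have in_ball: "Moebius_function 0 (-z) w \<in> ball 0 1" if "w \<in> ball 0 1" for w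
    using Moebius_function_norm_lt_1[of "-z" w 0] z1 that by simp
  have holF: "F holomorphic_on ball 0 1"
    unfolding F_def using z1 in_ball
    by (intro holomorphic_on_compose_gen[OF Moebius_function_holomorphic holf]) auto
  have G_coeff: "cmod (fps_nth G i) \<le> 4 * M / pi" if "i > 0" for i
    unfolding G_def using in_ball bound that
    by (intro taylor_coefficient_bound[OF holF]) (auto simp: F_def)
  have unit: "fps_nth (fps_const (complex_of_real s) - fps_const (cnj z) * fps_X) 0 \<noteq> 0"
    using s by simp
  have b: "b * (fps_const (of_real s) - fps_const (cnj z) * fps_X) = fps_X"
    unfolding b_def using unit by (simp add: fps_divide_unit mult.assoc inverse_mult_eq_1)
  have b0: "fps_nth b 0 = 0"
    using arg_cong[OF b, of "\<lambda>x. fps_nth x 0"] s by simp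

  \<comment> \<open>The expansion of \<open>f\<close> at \<open>z\<close> is computed in a second way, through \<open>f = F \<circ> Moebius_function 0 z\<close>.\<close>
  have "F has_fps_expansion G"
    unfolding G_def using holF
    by (intro analytic_at_imp_has_fps_expansion_0) (auto simp: analytic_at intro!: exI[of _ "ball 0 1"])
  moreover have "(\<lambda>u. u / (of_real s - cnj z * u)) has_fps_expansion b"
    unfolding b_def
    by (intro has_fps_expansion_divide' has_fps_expansion_diff has_fps_expansion_const
        has_fps_expansion_mult has_fps_expansion_fps_X unit)
  ultimately have "(F \<circ> (\<lambda>u. u / (of_real s - cnj z * u))) has_fps_expansion fps_compose G b"
    using b0 by (rule has_fps_expansion_compose)
  moreover have "\<forall>\<^sub>F u in nhds 0. (F \<circ> (\<lambda>u. u / (of_real s - cnj z * u))) u = f (z + u)"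
  proof -
    have "\<forall>\<^sub>F u in nhds 0. z + u \<in> ball 0 1"
      using z1 by (intro eventually_nhds_in_open[of "ball (-z) 1" "0::complex", THEN eventually_mono])
        (auto simp: dist_norm norm_minus_commute add.commute)
    then show ?thesis
    proof eventually_elim
      case (elim u)
      have "complex_of_real s - cnj z * u = 1 - cnj z * (z + u)"
        using complex_norm_square[of z] by (simp add: s_def algebra_simps)
      then have "u / (of_real s - cnj z * u) = Moebius_function 0 z (z + u)"
        by (simp add: Moebius_function_simple)
      moreover have "Moebius_function 0 (-z) (Moebius_function 0 z (z + u)) = z + u"
        using Moebius_function_compose[of "-z" "z" "z + u"] z1 elim by simp
      ultimately show ?case by (simp add: F_def)
    qed
  qed
  ultimately have "(\<lambda>u. f (z + u)) has_fps_expansion fps_compose G b"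
    by (rule iffD1[OF has_fps_expansion_cong[OF _ refl], rotated])
  moreover have "(\<lambda>u. f (z + u)) has_fps_expansion fps_expansion f z"
    using holf z by (intro analytic_at_imp_has_fps_expansion) (auto simp: analytic_at intro!: exI[of _ "ball 0 1"])
  ultimately have "fps_expansion f z = fps_compose G b"
    using fps_expansion_unique_complex by blast
  then have coeff: "(deriv ^^ n) f z / fact n = (\<Sum>i=0..n. fps_nth G i * fps_nth (b ^ i) n)"
    by (simp add: fps_eq_iff fps_expansion_def fps_compose_nth)
  obtain m where m: "n = Suc m" using \<open>n > 0\<close> by (cases n) auto
  have M: "0 \<le> M" using order.trans[OF abs_ge_zero bound[of 0]] by simp
  have "cmod ((deriv ^^ n) f z / fact n) = cmod (\<Sum>i=1..n. fps_nth G i * fps_nth (b ^ i) n)"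
    unfolding coeff using m by (simp add: sum.atLeast_Suc_atMost)
  also have "\<dots> \<le> (\<Sum>i=1..n. 4 * M / pi * cmod (fps_nth (b ^ i) n))"
  proof (rule sum_norm_le)
    fix i assume "i \<in> {1..n}"
    then show "cmod (fps_nth G i * fps_nth (b ^ i) n) \<le> 4 * M / pi * cmod (fps_nth (b ^ i) n)"
      unfolding norm_mult by (intro mult_right_mono G_coeff) auto
  qed
  also have "\<dots> \<le> 4 * M / pi * ((1 + cmod z) ^ m / s ^ Suc m)"
    unfolding sum_distrib_left[symmetric] m using M sum_norm_power_coeffs[OF b s, of m]
    by (intro mult_left_mono) auto
  also have "(1 + cmod z) ^ m / s ^ Suc m = 1 / ((1 - cmod z) ^ n * (1 + cmod z))"
  proof -
    have "p ^ m / (a * p) ^ Suc m = 1 / (a ^ Suc m * p)" if "a \<noteq> 0" "p \<noteq> 0" for a p :: real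
      using that by (simp add: power_mult_distrib)
    moreover have "1 - cmod z \<noteq> 0" "1 + cmod z \<noteq> 0"
      using z1 by (auto simp: add_pos_nonneg less_imp_neq[symmetric])
    ultimately show ?thesis unfolding s_factor m by blast
  qed
  finally have "cmod ((deriv ^^ n) f z) / fact n
      \<le> 4 * M / pi * (1 / ((1 - cmod z) ^ n * (1 + cmod z)))"
    by (simp only: norm_divide norm_fact)
  moreover have "d \<le> N * 4 * M / pi * K" if "d / N \<le> 4 * M / pi * K" "N > 0" for d N K :: real
    using that by (simp add: field_simps)
  ultimately show ?thesis using fact_gt_zero by blast
qed

section \<open>The estimate with the supremum\<close>

theorem corollary1p1:
  fixes f :: "complex \<Rightarrow> complex"
  assumes "f analytic_on ball 0 1"
  shows "\<forall>n\<ge>1. \<forall>z\<in>ball 0 1.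
    ereal (cmod ((deriv ^^ n) f z))
      \<le> ereal (fact n) * 4 * (SUP \<zeta>\<in>ball 0 1. ereal \<bar>Re (f \<zeta>)\<bar>) / ereal pi
          * ereal (1 / ((1 - cmod z) ^ n * (1 + cmod z)))"
proof (intro allI impI ballI)
  fix n :: nat and z :: complex
  assume n: "1 \<le> n" and z: "z \<in> ball 0 1"
  define S where "S = (SUP \<zeta>\<in>ball (0::complex) 1. ereal \<bar>Re (f \<zeta>)\<bar>)"
  have upper: "ereal \<bar>Re (f w)\<bar> \<le> S" if "w \<in> ball 0 1" for w
    unfolding S_def using that by (rule SUP_upper)
  have pos: "0 < 1 / ((1 - cmod z) ^ n * (1 + cmod z))"
    using z by (auto intro!: mult_pos_pos add_pos_nonneg)
  have "ereal (cmod ((deriv ^^ n) f z)) \<le> ereal (fact n) * 4 * S / ereal pi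
          * ereal (1 / ((1 - cmod z) ^ n * (1 + cmod z)))"
  proof (cases S)
    case (real M)
    have "cmod ((deriv ^^ n) f z) \<le> fact n * 4 * M / pi * (1 / ((1 - cmod z) ^ n * (1 + cmod z)))"
      using upper real n z
      by (intro higher_deriv_bound_bounded_Re analytic_imp_holomorphic assms) auto
    moreover have "ereal (fact n) * 4 * S / ereal pi = ereal (fact n * 4 * M / pi)"
      by (simp add: real ereal_divide)
    ultimately show ?thesis by (simp only: times_ereal.simps ereal_less_eq)
  next
    case PInf
    have infinite: "x * ereal y = \<infinity>" if "x = \<infinity>" "0 < y" for x y
      using that by simp
    have "ereal (fact n) * 4 * S = \<infinity>"
      using fact_gt_zero[of n, where 'a=real] by (simp add: PInf)
    then have "ereal (fact n) * 4 * S / ereal pi = \<infinity>" by simp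
    then have "ereal (fact n) * 4 * S / ereal pi * ereal (1 / ((1 - cmod z) ^ n * (1 + cmod z))) = \<infinity>"
      using pos by (rule infinite)
    then show ?thesis by (simp only: ereal_less_eq)
  next
    case MInf
    then show ?thesis using upper[of 0] by simp
  qed
  then show "ereal (cmod ((deriv ^^ n) f z))
      \<le> ereal (fact n) * 4 * (SUP \<zeta>\<in>ball 0 1. ereal \<bar>Re (f \<zeta>)\<bar>) / ereal pi
          * ereal (1 / ((1 - cmod z) ^ n * (1 + cmod z)))"
    unfolding S_def .
qed

end
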